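(* $(\mathbf{P},+,\times)$ is a commutative semiring, with additive identity $(0)$ (the null sequence) and multiplicative identity $(1)$ (the sequence $(1,0,0,\ldots)$).
   Context: A profile is a sequence $\mathbf{p}=(p_i)_{i\in\mathbb{N}}$ of natural numbers for which there exists $h\ge -1$ with $p_i\ge 1$ for $0\le i\le h$ and $p_i=0$ for $i>h$ (so the null sequence $(0)$ is a profile). Equivalently, the profiles are exactly the sequences $(|A|_i)_{i\in\mathbb{N}}$ where $(A,f)$ is a finite dynamical system ($A$ a finite, possibly empty, set and $f\colon A\to A$) and $|A|_i$ is the number of states $x\in A$ of height $i$, the height of $x$ being the least $h\ge 0$ such that $f^h(x)$ is periodic. $\mathbf{P}$ denotes the set of profiles. Sum: $\mathbf{p}+\mathbf{q}=(p_i+q_i)_{i\in\mathbb{N}}$. Product: $(\mathbf{p}\times\mathbf{q})_i = p_i\sum_{j=0}^i q_j + q_i\sum_{j=0}^i p_j - p_i q_i$ for all $i\in\mathbb{N}$. A profile is written as the finite sequence of its nonzero terms, e.g. $(2,1)=(2,1,0,0,\ldots)$. *)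

theory Defs
  imports "HOL-Algebra.Ring"
begin

(* The bound h is an integer so that h = -1 is allowed: it gives the null sequence. *)
definition is_profile :: "(nat \<Rightarrow> nat) \<Rightarrow> bool" where
  "is_profile p \<longleftrightarrow>
     (\<exists>h::int. h \<ge> -1 \<and> (\<forall>i::nat. (int i \<le> h \<longrightarrow> p i \<ge> 1) \<and> (int i > h \<longrightarrow> p i = 0)))"

definition profiles :: "(nat \<Rightarrow> nat) set" where
  "profiles = {p. is_profile p}"

definition profile_add :: "(nat \<Rightarrow> nat) \<Rightarrow> (nat \<Rightarrow> nat) \<Rightarrow> nat \<Rightarrow> nat" where
  "profile_add p q = (\<lambda>i. p i + q i)"

(* The subtraction on nat never truncates, see int_profile_mult below. *)
definition profile_mult :: "(nat \<Rightarrow> nat) \<Rightarrow> (nat \<Rightarrow> nat) \<Rightarrow> nat \<Rightarrow> nat" where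
  "profile_mult p q = (\<lambda>i. p i * (\<Sum>j=0..i. q j) + q i * (\<Sum>j=0..i. p j) - p i * q i)"

lemma int_profile_mult:
  "int (profile_mult p q i) =
     int (p i) * (\<Sum>j=0..i. int (q j)) + int (q i) * (\<Sum>j=0..i. int (p j)) - int (p i) * int (q i)"
proof -
  have "q i \<le> (\<Sum>j=0..i. q j)"
    by (rule member_le_sum) auto
  then have "p i * q i \<le> p i * (\<Sum>j=0..i. q j) + q i * (\<Sum>j=0..i. p j)"
    by (simp add: trans_le_add1)
  then show ?thesis
    by (simp add: profile_mult_def of_nat_diff)
qed

definition profile_zero :: "nat \<Rightarrow> nat" where
  "profile_zero = (\<lambda>i. 0)"

definition profile_one :: "nat \<Rightarrow> nat" where
  "profile_one = (\<lambda>i. if i = 0 then 1 else 0)"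

definition profile_semiring :: "(nat \<Rightarrow> nat) ring" where
  "profile_semiring =
     \<lparr>carrier = profiles, mult = profile_mult, one = profile_one,
      zero = profile_zero, add = profile_add\<rparr>"

end

(* The partial sums of p \<times> q are the products of the partial sums of p and q, and a sequence
   is determined by its partial sums. So the equational axioms are inherited from pointwise
   arithmetic of sequences of natural numbers, and only closure needs the shape of profiles:
   the supports {0, ..., m - 1} and {0, ..., n - 1} combine to one of length max m n,
   or to the empty one if m = 0 or n = 0 in the product. *)
theory Submission
  imports Defs
begin

text \<open>Here \<open>n\<close> is \<open>h + 1\<close>, the length of the support; being natural,
  it covers the null sequence with \<open>n = 0\<close>.\<close>

lemma is_profile_iff: "is_profile p \<longleftrightarrow> (\<exists>n. \<forall>i. 0 < p i \<longleftrightarrow> i < n)"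
proof
  assume "is_profile p"
  then obtain h :: int where "\<forall>i. (int i \<le> h \<longrightarrow> p i \<ge> 1) \<and> (int i > h \<longrightarrow> p i = 0)"
    unfolding is_profile_def by blast
  then have "0 < p i \<longleftrightarrow> i < nat (h + 1)" for i
    by (cases "int i \<le> h") (auto simp: Suc_le_eq)
  then show "\<exists>n. \<forall>i. 0 < p i \<longleftrightarrow> i < n"
    by blast
next
  assume "\<exists>n. \<forall>i. 0 < p i \<longleftrightarrow> i < n"
  then obtain n where n: "0 < p i \<longleftrightarrow> i < n" for i
    by blast
  have "(int i \<le> int n - 1 \<longrightarrow> p i \<ge> 1) \<and> (int i > int n - 1 \<longrightarrow> p i = 0)" for i
    using n[of i] by auto
  then show "is_profile p"
    unfolding is_profile_def by (intro exI[of _ "int n - 1"]) auto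
qed

text \<open>If the partial sums P and Q grow to P' = P + a and Q' = Q + b, their product grows by a
  Q' + b P' - a b, which is the next term of \<open>profile_mult p q\<close>.\<close>

lemma sum_profile_mult: "(\<Sum>j=0..i. profile_mult p q j) = (\<Sum>j=0..i. p j) * (\<Sum>j=0..i. q j)"
proof -
  \<comment> \<open>Over \<open>int\<close> the subtraction is a ring operation, so
    \<open>algebra_simps\<close> can settle the induction step.\<close>
  have "(\<Sum>j=0..i. int (profile_mult p q j)) = (\<Sum>j=0..i. int (p j)) * (\<Sum>j=0..i. int (q j))"
  proof (induction i)
    case 0
    show ?case by (simp add: int_profile_mult)
  next
    case (Suc i)
    then show ?case by (simp add: int_profile_mult[of p q "Suc i"] algebra_simps)
  qed
  then have "int (\<Sum>j=0..i. profile_mult p q j) = int ((\<Sum>j=0..i. p j) * (\<Sum>j=0..i. q j))"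
    by simp
  then show ?thesis
    by (simp only: of_nat_eq_iff)
qed

text \<open>Each later term is what separates two consecutive partial sums, so cancelling the
  shorter sum isolates it.\<close>

lemma eq_if_partial_sums_eq:
  fixes f g :: "nat \<Rightarrow> 'a::cancel_comm_monoid_add"
  assumes "\<And>i. (\<Sum>j=0..i. f j) = (\<Sum>j=0..i. g j)"
  shows "f = g"
proof
  fix i
  show "f i = g i"
    using assms[of i] assms[of "i - 1"] by (cases i) auto
qed

lemma profile_mult_assoc: "profile_mult (profile_mult p q) r = profile_mult p (profile_mult q r)"
  by (rule eq_if_partial_sums_eq) (simp only: sum_profile_mult mult.assoc)

lemma profile_mult_commute: "profile_mult p q = profile_mult q p"
  by (rule eq_if_partial_sums_eq) (simp only: sum_profile_mult mult.commute)

lemma profile_mult_one: "profile_mult profile_one p = p"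
  by (rule eq_if_partial_sums_eq) (simp add: sum_profile_mult profile_one_def)

lemma profile_mult_zero: "profile_mult profile_zero p = profile_zero"
  by (rule eq_if_partial_sums_eq) (simp add: sum_profile_mult profile_zero_def)

lemma profile_mult_add_distrib:
  "profile_mult (profile_add p q) r = profile_add (profile_mult p r) (profile_mult q r)"
proof (rule eq_if_partial_sums_eq)
  fix i
  have sum_add: "(\<Sum>j=0..i. profile_add f g j) = (\<Sum>j=0..i. f j) + (\<Sum>j=0..i. g j)" for f g
    by (simp add: profile_add_def sum.distrib)
  show "(\<Sum>j=0..i. profile_mult (profile_add p q) r j) =
        (\<Sum>j=0..i. profile_add (profile_mult p r) (profile_mult q r) j)"
    by (simp only: sum_profile_mult sum_add distrib_right)
qed

lemma is_profile_zero: "is_profile profile_zero"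
  unfolding is_profile_iff profile_zero_def by (rule exI[of _ 0]) simp

lemma is_profile_one: "is_profile profile_one"
  unfolding is_profile_iff profile_one_def by (rule exI[of _ 1]) simp

lemma is_profile_add:
  assumes "is_profile p" "is_profile q"
  shows "is_profile (profile_add p q)"
proof -
  obtain m n where "0 < p i \<longleftrightarrow> i < m" "0 < q i \<longleftrightarrow> i < n" for i
    using assms unfolding is_profile_iff by blast
  then have "0 < profile_add p q i \<longleftrightarrow> i < max m n" for i
    unfolding profile_add_def by (simp add: less_max_iff_disj)
  then show ?thesis
    unfolding is_profile_iff by blast
qed

text \<open>Once the subtraction is absorbed, \<open>p i\<close> and \<open>q i\<close> have
  cofactors that are positive because they contain \<open>q 0\<close> and
  \<open>p 0\<close>.\<close>

lemma profile_mult_pos_iff: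
  assumes "0 < p 0" "0 < q 0"
  shows "0 < profile_mult p q i \<longleftrightarrow> 0 < p i \<or> 0 < q i"
proof (cases i)
  case 0
  then show ?thesis using assms by (simp add: profile_mult_def)
next
  case (Suc k)
  \<comment> \<open>The subtracted \<open>p i * q i\<close> is the last summand of the first
    product, so that sum now stops at \<open>k\<close>.\<close>
  have "profile_mult p q i = p i * (\<Sum>j=0..k. q j) + q i * (\<Sum>j=0..i. p j)"
    unfolding profile_mult_def Suc by (simp add: algebra_simps)
  moreover have "0 < (\<Sum>j=0..k. q j)" "0 < (\<Sum>j=0..i. p j)"
    using assms by (auto intro!: sum_pos2[where i = 0])
  ultimately show ?thesis
    by simp
qed

lemma is_profile_mult:
  assumes "is_profile p" "is_profile q"
  shows "is_profile (profile_mult p q)"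
proof -
  obtain m n where m: "0 < p i \<longleftrightarrow> i < m" and n: "0 < q i \<longleftrightarrow> i < n" for i
    using assms unfolding is_profile_iff by blast
  \<comment> \<open>The third case yields \<open>0 < p 0\<close> and \<open>0 < q 0\<close>, as
    \<open>profile_mult_pos_iff\<close> requires.\<close>
  consider "m = 0" | "n = 0" | "0 < m" "0 < n"
    by blast
  then show ?thesis
  proof cases
    case 1
    then have "p = profile_zero"
      using m by (auto simp: profile_zero_def)
    then show ?thesis
      by (simp add: profile_mult_zero is_profile_zero)
  next
    case 2
    then have "q = profile_zero"
      using n by (auto simp: profile_zero_def)
    then show ?thesis
      by (simp add: profile_mult_commute[of p] profile_mult_zero is_profile_zero)
  next
    case 3
    then have "0 < profile_mult p q i \<longleftrightarrow> i < max m n" for i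
      using m n by (simp add: profile_mult_pos_iff less_max_iff_disj)
    then show ?thesis
      unfolding is_profile_iff by blast
  qed
qed

text \<open>The locale \<open>semiring\<close> leaves multiplication noncommutative;
  \<open>comm_monoid\<close> supplies commutativity.\<close>

theorem theorem1:
  shows "semiring profile_semiring \<and> comm_monoid profile_semiring"
proof
  have mult_one: "profile_mult p profile_one = p" for p
    by (simp add: profile_mult_commute[of p] profile_mult_one)
  show comm_monoid: "comm_monoid profile_semiring"
    by unfold_locales
      (auto simp: profile_semiring_def profiles_def is_profile_mult is_profile_one
        profile_mult_assoc profile_mult_one mult_one intro: profile_mult_commute)
  have "abelian_monoid profile_semiring"
    by (rule abelian_monoidI)
      (auto simp: profile_semiring_def profiles_def is_profile_add is_profile_zero,
       auto simp: profile_add_def profile_zero_def)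
  moreover have "monoid profile_semiring"
    using comm_monoid by (rule comm_monoid.axioms)
  moreover have "semiring_axioms profile_semiring"
    \<comment> \<open>The two instances of commutativity reduce the right-hand laws to the left-hand
      ones; the last \<open>simp\<close> reorders the products left over from
      distributivity.\<close>
    by unfold_locales
      (simp_all add: profile_semiring_def profile_mult_add_distrib profile_mult_zero
        profile_mult_commute[of _ "profile_add _ _"] profile_mult_commute[of _ profile_zero],
       simp add: profile_mult_commute)
  ultimately show "semiring profile_semiring"
    by (rule semiring.intro)
qed

end
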